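(* Let $w=(w(k))_{k=1}^\infty$ be a weight sequence such that $W(\infty)=\infty$. Suppose $\varphi$ is an Orlicz $N$-function that does not satisfy the $\Delta_2^0$ condition. Then any nonempty relatively weakly open subset of the unit ball of the Orlicz-Lorentz sequence space $\lambda_{\varphi,w}$ equipped with the Luxemburg norm has diameter two.
   Context: Decreasing means non-increasing. A weight sequence is a decreasing sequence $w=(w(k))_{k=1}^\infty$ of positive reals; $W(\infty)=\sum_{k=1}^\infty w(k)$. For a real sequence $x=(x(k))_{k=1}^\infty$, let $d_x(\lambda)$ be the number of $k$ with $|x(k)|>\lambda$, and let $x^*(k)=\inf\{\lambda>0:d_x(\lambda)<k\}$, $k\in\mathbb{N}$, be its decreasing rearrangement (values in $[0,\infty]$, $\inf\emptyset=\infty$). An Orlicz function is a convex $\varphi:[0,\infty)\to[0,\infty)$ with $\varphi(0)=0$ and $\varphi(u)>0$ for $u>0$ (and $\varphi(\infty)=\infty$). It is an Orlicz $N$-function if moreover $\lim_{u\to 0^+}\varphi(u)/u=0$ and $\lim_{u\to\infty}\varphi(u)/u=\infty$. $\varphi$ satisfies $\Delta_2^0$ if there are $K>0$, $u_0>0$ with $\varphi(2u)\le K\varphi(u)$ for all $0\le u\le u_0$. Let $\alpha(x)=\sum_{k=1}^\infty\varphi(x^*(k))w(k)$. The Orlicz-Lorentz sequence space is $\lambda_{\varphi,w}=\{x:\alpha(\lambda x)<\infty\text{ for some }\lambda>0\}$, a real Banach space with the Luxemburg norm $\|x\|=\inf\{\epsilon>0:\alpha(x/\epsilon)\le 1\}$.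 The unit ball is the closed unit ball; a relatively weakly open subset of it is its intersection with a weakly open subset of the space; diameter is taken in the Luxemburg norm. *)

theory Defs
  imports "HOL-Analysis.Analysis"
begin

text \<open>
  Sequences indexed by the positive integers are functions on \<^typ>\<open>nat\<close> shifted by one:
  the entry with index \<open>k + 1\<close> is the value at \<open>k\<close>. The vector operations on sequences are
  written out pointwise.
\<close>

definition weight_sequence :: "(nat \<Rightarrow> real) \<Rightarrow> bool" where
  "weight_sequence w \<longleftrightarrow> (\<forall>k. 0 < w k) \<and> decseq w"

definition total_weight :: "(nat \<Rightarrow> real) \<Rightarrow> ennreal" where
  "total_weight w = (\<Sum>k. ennreal (w k))"

text \<open>Only the values of \<open>\<phi>\<close> on \<open>[0,\<infinity>)\<close> are relevant below.\<close>

definition orlicz_function :: "(real \<Rightarrow> real) \<Rightarrow> bool" where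
  "orlicz_function \<phi> \<longleftrightarrow> convex_on {0..} \<phi> \<and> \<phi> 0 = 0 \<and> (\<forall>u>0. 0 < \<phi> u)"

definition orlicz_N_function :: "(real \<Rightarrow> real) \<Rightarrow> bool" where
  "orlicz_N_function \<phi> \<longleftrightarrow> orlicz_function \<phi> \<and>
     ((\<lambda>u. \<phi> u / u) \<longlongrightarrow> 0) (at_right 0) \<and>
     filterlim (\<lambda>u. \<phi> u / u) at_top at_top"

definition delta2_zero :: "(real \<Rightarrow> real) \<Rightarrow> bool" where
  "delta2_zero \<phi> \<longleftrightarrow>
     (\<exists>K>0. \<exists>u0>0. \<forall>u. 0 \<le> u \<and> u \<le> u0 \<longrightarrow> \<phi> (2 * u) \<le> K * \<phi> u)"

text \<open>The extension of \<open>\<phi>\<close> to \<open>[0,\<infinity>]\<close> by \<open>\<phi>(\<infinity>) = \<infinity>\<close>.\<close>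

definition orlicz_ext :: "(real \<Rightarrow> real) \<Rightarrow> ennreal \<Rightarrow> ennreal" where
  "orlicz_ext \<phi> t = (if t = \<infinity> then \<infinity> else ennreal (\<phi> (enn2real t)))"

text \<open>The case distinction is needed because \<^const>\<open>card\<close> is \<open>0\<close> on infinite sets.\<close>

definition distribution :: "(nat \<Rightarrow> real) \<Rightarrow> real \<Rightarrow> enat" where
  "distribution x l =
     (if finite {k. \<bar>x k\<bar> > l} then enat (card {k. \<bar>x k\<bar> > l}) else \<infinity>)"

text \<open>
  Because of the index shift, \<open>decr_rearr x k\<close> is the entry \<open>x\<^sup>*(k + 1)\<close> of the decreasing
  rearrangement.
\<close>

definition decr_rearr :: "(nat \<Rightarrow> real) \<Rightarrow> nat \<Rightarrow> ennreal" where
  "decr_rearr x k = Inf {ennreal l | l. 0 < l \<and> distribution x l < enat (Suc k)}"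

definition OL_modular :: "(real \<Rightarrow> real) \<Rightarrow> (nat \<Rightarrow> real) \<Rightarrow> (nat \<Rightarrow> real) \<Rightarrow> ennreal" where
  "OL_modular \<phi> w x = (\<Sum>k. orlicz_ext \<phi> (decr_rearr x k) * ennreal (w k))"

definition OL_space :: "(real \<Rightarrow> real) \<Rightarrow> (nat \<Rightarrow> real) \<Rightarrow> (nat \<Rightarrow> real) set" where
  "OL_space \<phi> w = {x. \<exists>l>0. OL_modular \<phi> w (\<lambda>k. l * x k) < \<infinity>}"

definition OL_norm :: "(real \<Rightarrow> real) \<Rightarrow> (nat \<Rightarrow> real) \<Rightarrow> (nat \<Rightarrow> real) \<Rightarrow> real" where
  "OL_norm \<phi> w x = Inf {e. 0 < e \<and> OL_modular \<phi> w (\<lambda>k. x k / e) \<le> 1}"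

definition OL_unit_ball :: "(real \<Rightarrow> real) \<Rightarrow> (nat \<Rightarrow> real) \<Rightarrow> (nat \<Rightarrow> real) set" where
  "OL_unit_ball \<phi> w = {x \<in> OL_space \<phi> w. OL_norm \<phi> w x \<le> 1}"

text \<open>
  Bounded linear functionals on the space; their values outside \<^const>\<open>OL_space\<close> are
  arbitrary and never used.
\<close>

definition OL_dual :: "(real \<Rightarrow> real) \<Rightarrow> (nat \<Rightarrow> real) \<Rightarrow> ((nat \<Rightarrow> real) \<Rightarrow> real) set" where
  "OL_dual \<phi> w = {f.
     (\<forall>x\<in>OL_space \<phi> w. \<forall>y\<in>OL_space \<phi> w. f (\<lambda>k. x k + y k) = f x + f y) \<and>
     (\<forall>c. \<forall>x\<in>OL_space \<phi> w. f (\<lambda>k. c * x k) = c * f x) \<and>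
     (\<exists>C. \<forall>x\<in>OL_space \<phi> w. \<bar>f x\<bar> \<le> C * OL_norm \<phi> w x)}"

definition OL_weak_topology :: "(real \<Rightarrow> real) \<Rightarrow> (nat \<Rightarrow> real) \<Rightarrow> (nat \<Rightarrow> real) topology" where
  "OL_weak_topology \<phi> w = topology_generated_by
     {{x \<in> OL_space \<phi> w. f x \<in> V} | f V. f \<in> OL_dual \<phi> w \<and> open V}"

text \<open>
  The supremum is taken in \<^typ>\<open>ereal\<close>, where it is meaningful without a boundedness side
  condition.
\<close>

definition OL_diameter :: "(real \<Rightarrow> real) \<Rightarrow> (nat \<Rightarrow> real) \<Rightarrow> (nat \<Rightarrow> real) set \<Rightarrow> ereal" where
  "OL_diameter \<phi> w S = (SUP (x, y) \<in> S \<times> S. ereal (OL_norm \<phi> w (\<lambda>k. x k - y k)))"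

end

theory Submission
  imports Defs
begin

text \<open>
  Without \<open>\<Delta>\<^sub>2\<^sup>0\<close> there are arbitrarily small heights \<open>u\<close> at which \<open>\<phi>(a u) / \<phi>(u)\<close> is as large as we
  please, for any fixed \<open>a > 1\<close>. As the total weight is infinite, suitably long blocks of height
  \<open>u\<close> have tiny modular although their norm is at least \<open>1 / a\<close>. Let \<open>Z\<^sub>n\<close> be such blocks with
  disjoint supports contained in disjoint sets \<open>C\<^sub>n\<close> and with modulars of finite sum. Given \<open>x\<close> in
  the weakly open set, pick \<open>c < 1\<close> such that \<open>y = c x\<close> still lies in it. All signed sums of the
  pieces of \<open>y\<close> on the \<open>C\<^sub>n\<close>, and of the \<open>Z\<^sub>n\<close>, are norm bounded, so both sequences of pieces
  are weakly null, and replacing \<open>y\<close> on \<open>C\<^sub>n\<close> by \<open>\<plusminus>Z\<^sub>n\<close> gives, for large \<open>n\<close>, two points of the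
  weakly open set; they lie in the unit ball since the modular of \<open>y\<close> is less than \<open>1\<close> by convexity.
  Their distance is \<open>2 \<parallel>Z\<^sub>n\<parallel> \<ge> 2 / a\<close>.
\<close>

section \<open>Distinct representatives, decreasing weights and bounds for the rearrangement\<close>

text \<open>When it is the turn of \<open>S n\<close>, only \<open>n\<close> points are taken, and
  \<open>S n\<close> has more than \<open>n\<close>. Later this turns lower bounds on the
  distribution function into an injective choice of positions.\<close>

lemma greedy_choice:
  fixes S :: "nat \<Rightarrow> 'a set"
  assumes "\<And>k. k < n \<Longrightarrow> infinite (S k) \<or> k < card (S k)"
  shows "\<exists>i. inj_on i {..<n} \<and> (\<forall>k<n. i k \<in> S k)"
  using assms
proof (induction n)
  case 0
  show ?case by simp
next
  case (Suc n)
  then obtain i where i: "inj_on i {..<n}" "\<forall>k<n. i k \<in> S k"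
    by fastforce
  have "\<not> S n \<subseteq> i ` {..<n}"
  proof
    assume sub: "S n \<subseteq> i ` {..<n}"
    then have "finite (S n)" "card (S n) \<le> n"
      using finite_subset card_mono[OF _ sub] card_image_le[of "{..<n}" i] by fastforce+
    then show False
      using Suc.prems[of n] by simp
  qed
  then obtain a where a: "a \<in> S n" "a \<notin> i ` {..<n}" by blast
  have "inj_on (i(n := a)) {..<Suc n}"
    using i a by (auto simp: inj_on_def less_Suc_eq)
  moreover have "\<forall>k<Suc n. (i(n := a)) k \<in> S k"
    using i a by (auto simp: less_Suc_eq)
  ultimately show ?case by blast
qed

text \<open>The largest element of a set of \<open>m + 1\<close> indices is at least
  \<open>m\<close>, so its weight is at most \<open>w m\<close>; remove it and induct.\<close>

lemma sum_decseq_le_initial: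
  fixes w :: "nat \<Rightarrow> real"
  assumes "decseq w" "\<And>k. 0 \<le> w k" "finite K" "card K \<le> m"
  shows "sum w K \<le> (\<Sum>k<m. w k)"
  using assms(3,4)
proof (induction m arbitrary: K)
  case 0
  then show ?case by simp
next
  case (Suc m)
  show ?case
  proof (cases "card K = Suc m")
    case True
    then have "K \<noteq> {}" by auto
    define p where "p = Max K"
    have p: "p \<in> K" using Suc.prems \<open>K \<noteq> {}\<close> by (simp add: p_def)
    have "K \<subseteq> {..p}" using Suc.prems by (auto simp: p_def)
    then have "card K \<le> Suc p" using card_mono[of "{..p}" K] by simp
    then have "w p \<le> w m" using True assms(1) by (simp add: decseqD)
    moreover have "sum w (K - {p}) \<le> (\<Sum>k<m. w k)"
      using Suc p by simp
    ultimately show ?thesis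
      using sum.remove[OF Suc.prems(1) p, of w] by simp
  next
    case False
    then have "sum w K \<le> (\<Sum>k<m. w k)" using Suc by simp
    then show ?thesis using assms(2)[of m] by simp
  qed
qed

lemma le_decr_rearr:
  assumes "finite J" "m < card J" "\<And>j. j \<in> J \<Longrightarrow> v \<le> \<bar>x j\<bar>"
  shows "ennreal v \<le> decr_rearr x m"
  unfolding decr_rearr_def
proof (rule Inf_greatest, clarify)
  fix l :: real
  assume l: "0 < l" and d: "distribution x l < enat (Suc m)"
  have fin: "finite {k. l < \<bar>x k\<bar>}"
    using d by (auto simp: distribution_def split: if_splits)
  then have "card {k. l < \<bar>x k\<bar>} < Suc m"
    using d by (simp add: distribution_def)
  then have "\<not> J \<subseteq> {k. l < \<bar>x k\<bar>}"
    using card_mono[OF fin, of J] assms(2) by auto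
  then obtain j where "j \<in> J" "\<bar>x j\<bar> \<le> l" by fastforce
  then show "ennreal v \<le> ennreal l"
    using assms(3)[of j] by (intro ennreal_leI) simp
qed

lemma distribution_ge_of_less_decr_rearr:
  assumes "0 < l" "ennreal l < decr_rearr x k"
  shows "infinite {j. l < \<bar>x j\<bar>} \<or> k < card {j. l < \<bar>x j\<bar>}"
proof (rule ccontr)
  assume "\<not> ?thesis"
  then have "distribution x l < enat (Suc k)"
    by (simp add: distribution_def)
  then have "decr_rearr x k \<le> ennreal l"
    unfolding decr_rearr_def using assms(1) by (intro Inf_lower) blast
  then show False using assms(2) by simp
qed

section \<open>Orlicz functions: consequences of convexity\<close>

locale orlicz_lorentz =
  fixes \<phi> :: "real \<Rightarrow> real" and w :: "nat \<Rightarrow> real"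
  assumes orlicz: "orlicz_function \<phi>" and weight: "weight_sequence w"
begin

lemma phi_zero [simp]: "\<phi> 0 = 0"
  and phi_pos: "0 < u \<Longrightarrow> 0 < \<phi> u"
  and phi_convex: "convex_on {0..} \<phi>"
  using orlicz by (auto simp: orlicz_function_def)

lemma w_pos: "0 < w k" and w_decseq: "decseq w"
  using weight by (auto simp: weight_sequence_def)

lemma w_nonneg: "0 \<le> w k"
  using w_pos[of k] by simp

lemma phi_nonneg: "0 \<le> u \<Longrightarrow> 0 \<le> \<phi> u"
  using phi_pos[of u] by (cases "u = 0") auto

lemma phi_convexD:
  assumes "0 \<le> u" "0 \<le> v" "0 \<le> s" "s \<le> 1"
  shows "\<phi> (s * u + (1 - s) * v) \<le> s * \<phi> u + (1 - s) * \<phi> v"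
  using convex_onD[OF phi_convex, of "1 - s" u v] assms by simp

lemma phi_scale:
  assumes "0 \<le> u" "0 \<le> s" "s \<le> 1"
  shows "\<phi> (s * u) \<le> s * \<phi> u"
  using phi_convexD[of u 0 s] assms by simp

text \<open>Monotonicity follows from convexity and \<open>\<phi> 0 = 0\<close>: write
  \<open>u\<close> as the multiple \<open>u / v\<close> of \<open>v\<close>.\<close>

lemma phi_mono:
  assumes "0 \<le> u" "u \<le> v"
  shows "\<phi> u \<le> \<phi> v"
proof (cases "v = 0")
  case False
  then have "\<phi> (u / v * v) \<le> u / v * \<phi> v" "u / v * \<phi> v \<le> 1 * \<phi> v"
    using assms by (intro phi_scale mult_right_mono phi_nonneg; simp add: field_simps)+
  then show ?thesis using False by simp
qed (use assms in auto)

lemma orlicz_ext_mono: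
  assumes "0 \<le> u" "ennreal u \<le> t"
  shows "ennreal (\<phi> u) \<le> orlicz_ext \<phi> t"
proof (cases t)
  case (real r)
  then show ?thesis using assms by (auto simp: orlicz_ext_def intro!: ennreal_leI phi_mono)
qed (simp add: orlicz_ext_def)

section \<open>Modular bounds over injective pairings of entries with weights\<close>

text \<open>
  The modular is the supremum of the sums below, at least up to a dilation by a factor
  arbitrarily close to one, and such a dilation does not affect the norm. Allowing arbitrary
  finite sets \<open>K\<close> of weight indices makes the orthogonal subadditivity immediate.
\<close>

definition modular_le :: "(nat \<Rightarrow> real) \<Rightarrow> real \<Rightarrow> bool" where
  "modular_le x c \<longleftrightarrow>
     (\<forall>K (i :: nat \<Rightarrow> nat). finite K \<longrightarrow> inj_on i K \<longrightarrow> (\<Sum>k\<in>K. \<phi> \<bar>x (i k)\<bar> * w k) \<le> c)"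

lemma modular_leD:
  "modular_le x c \<Longrightarrow> finite K \<Longrightarrow> inj_on i K \<Longrightarrow> (\<Sum>k\<in>K. \<phi> \<bar>x (i k)\<bar> * w k) \<le> c"
  by (simp add: modular_le_def)

lemma modular_le_mono:
  assumes "modular_le y b" "\<And>k. \<bar>x k\<bar> \<le> \<bar>y k\<bar>" "b \<le> c"
  shows "modular_le x c"
  unfolding modular_le_def
proof (intro allI impI)
  fix K and i :: "nat \<Rightarrow> nat"
  assume K: "finite K" "inj_on i K"
  have "(\<Sum>k\<in>K. \<phi> \<bar>x (i k)\<bar> * w k) \<le> (\<Sum>k\<in>K. \<phi> \<bar>y (i k)\<bar> * w k)"
    by (intro sum_mono mult_right_mono phi_mono assms(2) w_nonneg) simp
  also have "\<dots> \<le> c"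
    using modular_leD[OF assms(1) K] assms(3) by simp
  finally show "(\<Sum>k\<in>K. \<phi> \<bar>x (i k)\<bar> * w k) \<le> c" .
qed

text \<open>Both sequences and their combination are tested with the same \<open>K\<close> and
  \<open>i\<close>, so convexity of \<open>\<phi>\<close> applies entry by entry.\<close>

lemma modular_le_convex:
  assumes "modular_le x a" "modular_le y b" "0 \<le> s" "s \<le> 1"
  shows "modular_le (\<lambda>k. s * x k + (1 - s) * y k) (s * a + (1 - s) * b)"
  unfolding modular_le_def
proof (intro allI impI)
  fix K and i :: "nat \<Rightarrow> nat"
  assume K: "finite K" "inj_on i K"
  have "(\<Sum>k\<in>K. \<phi> \<bar>s * x (i k) + (1 - s) * y (i k)\<bar> * w k)
      \<le> (\<Sum>k\<in>K. (s * \<phi> \<bar>x (i k)\<bar> + (1 - s) * \<phi> \<bar>y (i k)\<bar>) * w k)"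
  proof (intro sum_mono mult_right_mono w_nonneg)
    fix k
    have "\<bar>s * x (i k) + (1 - s) * y (i k)\<bar> \<le> s * \<bar>x (i k)\<bar> + (1 - s) * \<bar>y (i k)\<bar>"
      using abs_triangle_ineq[of "s * x (i k)" "(1 - s) * y (i k)"] assms(3,4)
      by (simp add: abs_mult)
    then have "\<phi> \<bar>s * x (i k) + (1 - s) * y (i k)\<bar> \<le> \<phi> (s * \<bar>x (i k)\<bar> + (1 - s) * \<bar>y (i k)\<bar>)"
      by (intro phi_mono) auto
    also have "\<dots> \<le> s * \<phi> \<bar>x (i k)\<bar> + (1 - s) * \<phi> \<bar>y (i k)\<bar>"
      using assms(3,4) by (intro phi_convexD) auto
    finally show "\<phi> \<bar>s * x (i k) + (1 - s) * y (i k)\<bar> \<le> \<dots>" .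
  qed
  also have "\<dots> = s * (\<Sum>k\<in>K. \<phi> \<bar>x (i k)\<bar> * w k) + (1 - s) * (\<Sum>k\<in>K. \<phi> \<bar>y (i k)\<bar> * w k)"
    by (simp add: sum.distrib sum_distrib_left distrib_right mult.assoc)
  also have "\<dots> \<le> s * a + (1 - s) * b"
    using assms modular_leD[OF assms(1) K] modular_leD[OF assms(2) K]
    by (intro add_mono mult_left_mono) auto
  finally show "(\<Sum>k\<in>K. \<phi> \<bar>s * x (i k) + (1 - s) * y (i k)\<bar> * w k) \<le> \<dots>" .
qed

lemma modular_le_scale:
  assumes "modular_le x a" "0 \<le> s" "s \<le> 1"
  shows "modular_le (\<lambda>k. s * x k) (s * a)"
proof -
  have "modular_le (\<lambda>k. 0) 0"
    by (simp add: modular_le_def)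
  from modular_le_convex[OF assms(1) this assms(2,3)] show ?thesis by simp
qed

text \<open>Split \<open>K\<close> by whether \<open>i k\<close> lies in \<open>A\<close>; each half
  with the restricted \<open>i\<close> is again admissible in \<open>modular_le\<close>. This serves
  to put a block in place of a piece of a vector.\<close>

lemma modular_le_orthogonal_add:
  assumes "modular_le x a" "modular_le y b"
    and z: "\<And>k. k \<in> A \<Longrightarrow> \<bar>z k\<bar> \<le> \<bar>x k\<bar>" "\<And>k. k \<notin> A \<Longrightarrow> \<bar>z k\<bar> \<le> \<bar>y k\<bar>"
  shows "modular_le z (a + b)"
  unfolding modular_le_def
proof (intro allI impI)
  fix K and i :: "nat \<Rightarrow> nat"
  assume K: "finite K" "inj_on i K"
  let ?f = "\<lambda>x k. \<phi> \<bar>x (i k)\<bar> * w k"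
  let ?A = "{k \<in> K. i k \<in> A}" and ?B = "{k \<in> K. i k \<notin> A}"
  have "K = ?A \<union> ?B" by blast
  then have "sum (?f z) K = sum (?f z) (?A \<union> ?B)" by (rule arg_cong)
  also have "\<dots> = sum (?f z) ?A + sum (?f z) ?B"
    using K by (intro sum.union_disjoint) auto
  also have "\<dots> \<le> sum (?f x) ?A + sum (?f y) ?B"
    by (intro add_mono sum_mono mult_right_mono phi_mono w_nonneg) (auto intro: z)
  also have "\<dots> \<le> a + b"
    using K by (intro add_mono modular_leD[OF assms(1)] modular_leD[OF assms(2)])
      (auto elim: inj_on_subset)
  finally show "sum (?f z) K \<le> a + b" .
qed

section \<open>Comparison with the decreasing rearrangement\<close>

text \<open>Rearrangement inequality: a swap puts the smallest entry at the largest index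
  \<open>p\<close>. Since \<open>m \<le> p\<close>, its weight is at most \<open>w m\<close>; and it
  is at most \<open>decr_rearr x m\<close>, because all \<open>m + 1\<close> entries are at least as
  large. Remove it and induct.\<close>

lemma rearrangement_le_decr_rearr:
  assumes "finite K" "inj_on i K" "card K = m"
  shows "(\<Sum>k\<in>K. ennreal (\<phi> \<bar>x (i k)\<bar> * w k))
    \<le> (\<Sum>j<m. orlicz_ext \<phi> (decr_rearr x j) * ennreal (w j))"
  using assms
proof (induction m arbitrary: K i)
  case 0
  then show ?case by simp
next
  case (Suc m)
  let ?a = "\<lambda>i k. \<phi> \<bar>x (i k)\<bar>"
  have ne: "K \<noteq> {}" using Suc.prems by auto
  define q where "q = arg_min_on (\<lambda>k. \<bar>x (i k)\<bar>) K"
  have q: "q \<in> K" "\<And>k. k \<in> K \<Longrightarrow> \<bar>x (i q)\<bar> \<le> \<bar>x (i k)\<bar>"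
    using arg_min_if_finite[OF Suc.prems(1) ne, of "\<lambda>k. \<bar>x (i k)\<bar>"]
    by (force simp: q_def not_less)+
  define p where "p = Max K"
  have p: "p \<in> K" "q \<le> p" using Suc.prems ne q by (auto simp: p_def)
  have "K \<subseteq> {..p}" using Suc.prems by (auto simp: p_def)
  then have "m \<le> p" using card_mono[of "{..p}" K] Suc.prems by simp
  then have wpm: "w p \<le> w m" using w_decseq by (simp add: decseqD)
  define i' where "i' = i \<circ> Transposition.transpose p q"
  have "Transposition.transpose p q ` K = K"
    using p(1) q(1) by simp
  then have inj': "inj_on i' K"
    unfolding i'_def using Suc.prems(2) by (intro comp_inj_on) simp_all
  have i'p: "i' p = i q" and i'q: "i' q = i p"
    by (simp_all add: i'_def)
  have i'other: "i' k = i k" if "k \<noteq> p" "k \<noteq> q" for k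
    using that by (simp add: i'_def)
  \<comment> \<open>moving the smallest entry to the smallest weight increases the sum\<close>
  have swap: "(\<Sum>k\<in>K. ?a i k * w k) \<le> (\<Sum>k\<in>K. ?a i' k * w k)"
  proof (cases "p = q")
    case True
    then show ?thesis by (simp add: i'_def)
  next
    case False
    have split: "(\<Sum>k\<in>K. f k) = f p + f q + (\<Sum>k\<in>K - {p, q}. f k)" for f :: "nat \<Rightarrow> real"
    proof -
      have "(\<Sum>k\<in>K. f k) = (\<Sum>k\<in>K - {p, q}. f k) + (\<Sum>k\<in>{p, q}. f k)"
        using Suc.prems p q by (intro sum.subset_diff) auto
      then show ?thesis using False by simp
    qed
    have rest: "(\<Sum>k\<in>K - {p, q}. ?a i k * w k) = (\<Sum>k\<in>K - {p, q}. ?a i' k * w k)"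
      by (intro sum.cong) (auto simp: i'other)
    \<comment> \<open>This product is exactly what the swap adds to the sum.\<close>
    have "0 \<le> (?a i p - ?a i q) * (w q - w p)"
      using q(2)[OF p(1)] p(2) w_decseq by (intro mult_nonneg_nonneg) (auto intro: phi_mono simp: decseqD)
    then show ?thesis
      unfolding split[of "\<lambda>k. ?a i k * w k"] split[of "\<lambda>k. ?a i' k * w k"] rest i'p i'q
      by (simp add: algebra_simps)
  qed
  have "ennreal \<bar>x (i q)\<bar> \<le> decr_rearr x m"
    using Suc.prems q by (intro le_decr_rearr[of "i ` K"]) (auto simp: card_image)
  then have last: "ennreal (?a i' p * w p) \<le> orlicz_ext \<phi> (decr_rearr x m) * ennreal (w m)"
    unfolding i'p using wpm
    by (subst ennreal_mult) (auto intro!: mult_mono orlicz_ext_mono phi_nonneg w_nonneg ennreal_leI)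
  have "(\<Sum>k\<in>K. ennreal (?a i k * w k)) = ennreal (\<Sum>k\<in>K. ?a i k * w k)"
    by (intro sum_ennreal) (simp add: phi_nonneg w_nonneg)
  also have "\<dots> \<le> ennreal (\<Sum>k\<in>K. ?a i' k * w k)"
    by (intro ennreal_leI swap)
  also have "\<dots> = (\<Sum>k\<in>K. ennreal (?a i' k * w k))"
    by (intro sum_ennreal[symmetric]) (simp add: phi_nonneg w_nonneg)
  also have "\<dots> = ennreal (?a i' p * w p) + (\<Sum>k\<in>K - {p}. ennreal (?a i' k * w k))"
    using Suc.prems p by (intro sum.remove) auto
  also have "\<dots> \<le> orlicz_ext \<phi> (decr_rearr x m) * ennreal (w m)
      + (\<Sum>j<m. orlicz_ext \<phi> (decr_rearr x j) * ennreal (w j))"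
    using Suc.prems p by (intro add_mono last Suc.IH inj_on_subset[OF inj']) auto
  finally show ?case by (simp add: add.commute)
qed

lemma modular_le_of_OL_modular:
  assumes "OL_modular \<phi> w x \<le> ennreal c" "0 \<le> c"
  shows "modular_le x c"
  unfolding modular_le_def
proof (intro allI impI)
  fix K and i :: "nat \<Rightarrow> nat"
  assume K: "finite K" "inj_on i K"
  have "ennreal (\<Sum>k\<in>K. \<phi> \<bar>x (i k)\<bar> * w k) = (\<Sum>k\<in>K. ennreal (\<phi> \<bar>x (i k)\<bar> * w k))"
    by (intro sum_ennreal[symmetric]) (simp add: phi_nonneg w_nonneg)
  also have "\<dots> \<le> (\<Sum>j<card K. orlicz_ext \<phi> (decr_rearr x j) * ennreal (w j))"
    by (rule rearrangement_le_decr_rearr[OF K refl])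
  also have "\<dots> \<le> OL_modular \<phi> w x"
    unfolding OL_modular_def by (intro sum_le_suminf) auto
  also note assms(1)
  finally show "(\<Sum>k\<in>K. \<phi> \<bar>x (i k)\<bar> * w k) \<le> c"
    using assms(2) by simp
qed

text \<open>For \<open>v > 1\<close> convexity gives \<open>v * \<phi> 1 \<le> \<phi> v\<close>, and
  pairing a single entry with \<open>w 0\<close> bounds \<open>\<phi>\<close> of it. The bound keeps
  the decreasing rearrangement finite.\<close>

lemma modular_le_bounded:
  assumes "modular_le x c"
  shows "\<exists>M>0. \<forall>k. \<bar>x k\<bar> \<le> M"
proof (intro exI conjI allI)
  define M where "M = max 1 (c / (\<phi> 1 * w 0))"
  show "0 < M" by (simp add: M_def)
  fix k
  show "\<bar>x k\<bar> \<le> M"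
  proof (cases "\<bar>x k\<bar> \<le> 1")
    case False
    have "\<phi> (1 / \<bar>x k\<bar> * \<bar>x k\<bar>) \<le> 1 / \<bar>x k\<bar> * \<phi> \<bar>x k\<bar>"
      using False by (intro phi_scale) auto
    moreover have "1 / \<bar>x k\<bar> * \<bar>x k\<bar> = 1" using False by auto
    ultimately have "\<phi> 1 \<le> 1 / \<bar>x k\<bar> * \<phi> \<bar>x k\<bar>" by simp
    moreover have "0 < \<bar>x k\<bar>" using False by linarith
    ultimately have "\<bar>x k\<bar> * \<phi> 1 \<le> \<phi> \<bar>x k\<bar>" by (simp add: field_simps)
    then have "\<bar>x k\<bar> * \<phi> 1 * w 0 \<le> \<phi> \<bar>x k\<bar> * w 0"
      by (intro mult_right_mono w_nonneg)
    also have "\<dots> \<le> c"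
      using modular_leD[OF assms, of "{0}" "\<lambda>_. k"] by simp
    finally have "\<bar>x k\<bar> \<le> c / (\<phi> 1 * w 0)"
      using phi_pos[of 1] w_pos[of 0] by (simp add: field_simps)
    then show ?thesis by (simp add: M_def)
  qed (simp add: M_def)
qed

text \<open>The infimum in \<open>decr_rearr\<close> need not be attained by an entry, but
  \<open>t\<close> times a positive value of it is exceeded at more than \<open>k\<close> positions.
  Distinct such positions can be chosen greedily, and the dilation pays for the lost factor
  \<open>t\<close>.\<close>

lemma OL_modular_dilation_le:
  assumes x: "modular_le x c" and t: "0 < t" "t < 1"
  shows "OL_modular \<phi> w (\<lambda>k. t * x k) \<le> ennreal c"
  unfolding OL_modular_def
proof (rule suminf_le_const[OF summableI])
  fix n
  let ?y = "\<lambda>k. t * x k"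
  define r where "r k = enn2real (decr_rearr ?y k)" for k
  have fin: "decr_rearr ?y k < \<infinity>" for k
  proof -
    obtain M where M: "0 < M" "\<And>k. \<bar>?y k\<bar> \<le> M"
      using modular_le_bounded[OF modular_le_scale[OF x, of t]] t by auto
    then have "{k. M < \<bar>?y k\<bar>} = {}" by (auto simp: not_less)
    then have "distribution ?y M < enat (Suc k)" by (simp add: distribution_def)
    then have "decr_rearr ?y k \<le> ennreal M"
      unfolding decr_rearr_def using M(1) by (intro Inf_lower) blast
    then show ?thesis using ennreal_less_top order_le_less_trans by fastforce
  qed
  have r: "decr_rearr ?y k = ennreal (r k)" for k
    using fin[of k] by (simp add: r_def)
  have r0: "0 \<le> r k" for k by (simp add: r_def)
  \<comment> \<open>Where \<open>r k = 0\<close> any position will do; \<open>UNIV\<close> keeps the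
    hypothesis of \<open>greedy_choice\<close> true there.\<close>
  define S where "S k = (if 0 < r k then {j. t * r k < \<bar>?y j\<bar>} else UNIV)" for k
  have "infinite (S k) \<or> k < card (S k)" for k
  proof (cases "0 < r k")
    case True
    have "ennreal (t * r k) < decr_rearr ?y k"
      unfolding r using True t by (intro ennreal_lessI) auto
    then show ?thesis
      using distribution_ge_of_less_decr_rearr[of "t * r k" ?y k] True t by (simp add: S_def)
  qed (simp add: S_def)
  then obtain i where i: "inj_on i {..<n}" "\<And>k. k < n \<Longrightarrow> i k \<in> S k"
    using greedy_choice[of n S] by auto
  have ri: "r k \<le> \<bar>x (i k)\<bar>" if "k < n" for k
    using i(2)[OF that] r0[of k] t by (auto simp: S_def abs_mult split: if_splits)
  have "(\<Sum>k<n. orlicz_ext \<phi> (decr_rearr ?y k) * ennreal (w k)) = (\<Sum>k<n. ennreal (\<phi> (r k) * w k))"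
    by (intro sum.cong refl) (simp add: r orlicz_ext_def r0 ennreal_mult phi_nonneg w_nonneg)
  also have "\<dots> = ennreal (\<Sum>k<n. \<phi> (r k) * w k)"
    by (intro sum_ennreal) (simp add: phi_nonneg w_nonneg r0)
  also have "(\<Sum>k<n. \<phi> (r k) * w k) \<le> (\<Sum>k<n. \<phi> \<bar>x (i k)\<bar> * w k)"
    by (intro sum_mono mult_right_mono phi_mono w_nonneg ri r0) auto
  also have "\<dots> \<le> c" by (intro modular_leD[OF x] i) auto
  finally show "(\<Sum>k<n. orlicz_ext \<phi> (decr_rearr ?y k) * ennreal (w k)) \<le> ennreal c"
    by (simp add: ennreal_leI)
qed

section \<open>The space, the Luxemburg norm and the unit ball\<close>

text \<open>Forwards, a finite modular is at most some \<open>c \<ge> 1\<close>, and by convexity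
  the factor \<open>1 / c\<close> brings the bound down to 1. Backwards, halving \<open>l\<close>
  provides the dilation.\<close>

lemma OL_space_iff: "x \<in> OL_space \<phi> w \<longleftrightarrow> (\<exists>l>0. modular_le (\<lambda>k. l * x k) 1)"
proof
  assume "x \<in> OL_space \<phi> w"
  then obtain l where l: "0 < l" "OL_modular \<phi> w (\<lambda>k. l * x k) < \<infinity>"
    by (auto simp: OL_space_def)
  define c where "c = max 1 (enn2real (OL_modular \<phi> w (\<lambda>k. l * x k)))"
  have "OL_modular \<phi> w (\<lambda>k. l * x k) = ennreal (enn2real (OL_modular \<phi> w (\<lambda>k. l * x k)))"
    using l by simp
  also have "\<dots> \<le> ennreal c" by (intro ennreal_leI) (simp add: c_def)
  finally have "modular_le (\<lambda>k. l * x k) c"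
    by (rule modular_le_of_OL_modular) (simp add: c_def)
  then have "modular_le (\<lambda>k. (1 / c) * (l * x k)) (1 / c * c)"
    by (rule modular_le_scale) (auto simp: c_def)
  moreover have "c > 0" by (simp add: c_def)
  ultimately show "\<exists>l>0. modular_le (\<lambda>k. l * x k) 1"
    using l by (intro exI[of _ "l / c"]) simp
next
  assume "\<exists>l>0. modular_le (\<lambda>k. l * x k) 1"
  then obtain l where l: "0 < l" "modular_le (\<lambda>k. l * x k) 1" by auto
  then have "OL_modular \<phi> w (\<lambda>k. 1 / 2 * (l * x k)) \<le> ennreal 1"
    by (intro OL_modular_dilation_le) auto
  then have "OL_modular \<phi> w (\<lambda>k. l / 2 * x k) \<le> ennreal 1" by simp
  then show "x \<in> OL_space \<phi> w"
    unfolding OL_space_def using l ennreal_less_top order_le_less_trans by (intro CollectI exI[of _ "l / 2"]) fastforce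
qed

lemma OL_space_scale:
  assumes "x \<in> OL_space \<phi> w"
  shows "(\<lambda>k. c * x k) \<in> OL_space \<phi> w"
proof -
  obtain l where l: "0 < l" "modular_le (\<lambda>k. l * x k) 1"
    using assms by (auto simp: OL_space_iff)
  have "modular_le (\<lambda>k. l / (1 + \<bar>c\<bar>) * (c * x k)) 1"
  proof (rule modular_le_mono[OF l(2) _ order.refl])
    fix k
    have "\<bar>c\<bar> * (l * \<bar>x k\<bar>) \<le> (1 + \<bar>c\<bar>) * (l * \<bar>x k\<bar>)"
      using l(1) by (intro mult_right_mono) auto
    then show "\<bar>l / (1 + \<bar>c\<bar>) * (c * x k)\<bar> \<le> \<bar>l * x k\<bar>"
      using l(1) by (simp add: abs_mult field_simps)
  qed
  then show ?thesis
    unfolding OL_space_iff using l(1) by (intro exI[of _ "l / (1 + \<bar>c\<bar>)"]) auto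
qed

lemma OL_space_add:
  assumes "x \<in> OL_space \<phi> w" "y \<in> OL_space \<phi> w"
  shows "(\<lambda>k. x k + y k) \<in> OL_space \<phi> w"
proof -
  obtain l m where l: "0 < l" "modular_le (\<lambda>k. l * x k) 1" and m: "0 < m" "modular_le (\<lambda>k. m * y k) 1"
    using assms by (auto simp: OL_space_iff)
  \<comment> \<open>This weight equalises the coefficients:
    \<open>s * l = (1 - s) * m = l * m / (l + m)\<close>.\<close>
  define s where "s = m / (l + m)"
  have s: "0 \<le> s" "s \<le> 1" using l m by (auto simp: s_def)
  have s': "1 - s = l / (l + m)" using l m by (simp add: s_def field_simps)
  have "s * (l * x k) + (1 - s) * (m * y k) = l * m / (l + m) * (x k + y k)" for k
    unfolding s' by (simp add: s_def algebra_simps add_divide_distrib)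
  with modular_le_convex[OF l(2) m(2) s]
  have "modular_le (\<lambda>k. l * m / (l + m) * (x k + y k)) 1" by simp
  moreover have "0 < l * m / (l + m)" using l m by simp
  ultimately show ?thesis unfolding OL_space_iff by blast
qed

lemma OL_space_solid:
  assumes "y \<in> OL_space \<phi> w" "\<And>k. \<bar>x k\<bar> \<le> \<bar>y k\<bar>"
  shows "x \<in> OL_space \<phi> w"
proof -
  obtain l where l: "0 < l" "modular_le (\<lambda>k. l * y k) 1"
    using assms by (auto simp: OL_space_iff)
  have "modular_le (\<lambda>k. l * x k) 1"
    by (rule modular_le_mono[OF l(2)]) (use l assms(2) in \<open>auto simp: abs_mult\<close>)
  then show ?thesis unfolding OL_space_iff using l(1) by blast
qed

text \<open>Dilation by \<open>e / e'\<close> makes every \<open>e' > e\<close> admissible in the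
  infimum, which therefore is at most \<open>e\<close>.\<close>

lemma OL_norm_le:
  assumes "0 < e" "modular_le (\<lambda>k. x k / e) 1"
  shows "OL_norm \<phi> w x \<le> e"
proof (rule dense_ge)
  fix e' assume e': "e < e'"
  have "OL_modular \<phi> w (\<lambda>k. e / e' * (x k / e)) \<le> ennreal 1"
    using assms e' by (intro OL_modular_dilation_le) auto
  then have "OL_modular \<phi> w (\<lambda>k. x k / e') \<le> 1" using assms by simp
  then show "OL_norm \<phi> w x \<le> e'"
    unfolding OL_norm_def using assms e' by (intro cInf_lower bdd_belowI[of _ 0]) auto
qed

lemma OL_space_norm_set_nonempty:
  assumes "x \<in> OL_space \<phi> w"
  shows "{e. 0 < e \<and> OL_modular \<phi> w (\<lambda>k. x k / e) \<le> 1} \<noteq> {}"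
proof -
  obtain l where l: "0 < l" "modular_le (\<lambda>k. l * x k) 1"
    using assms by (auto simp: OL_space_iff)
  then have "OL_modular \<phi> w (\<lambda>k. 1 / 2 * (l * x k)) \<le> ennreal 1"
    by (intro OL_modular_dilation_le) auto
  then show ?thesis using l(1)
    by (auto intro!: exI[of _ "2 / l"] simp: mult.commute)
qed

lemma OL_norm_nonneg:
  assumes "x \<in> OL_space \<phi> w"
  shows "0 \<le> OL_norm \<phi> w x"
  unfolding OL_norm_def
  by (rule cInf_greatest[OF OL_space_norm_set_nonempty[OF assms]]) auto

lemma modular_le_of_OL_norm_less:
  assumes "x \<in> OL_space \<phi> w" "OL_norm \<phi> w x < e"
  shows "modular_le (\<lambda>k. x k / e) 1"
proof -
  obtain d where d: "0 < d" "OL_modular \<phi> w (\<lambda>k. x k / d) \<le> 1" "d < e"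
    using cInf_lessD[OF OL_space_norm_set_nonempty[OF assms(1)]] assms(2)
    unfolding OL_norm_def by auto
  then have "modular_le (\<lambda>k. x k / d) 1"
    by (intro modular_le_of_OL_modular) auto
  then show ?thesis
    by (rule modular_le_mono) (use d in \<open>auto simp: abs_divide intro!: divide_left_mono\<close>)
qed

lemma OL_unit_ballI:
  assumes "modular_le x 1"
  shows "x \<in> OL_unit_ball \<phi> w"
  unfolding OL_unit_ball_def OL_space_iff
  using assms OL_norm_le[of 1 x] by (auto intro!: exI[of _ 1])

lemma OL_unit_ballD:
  assumes "x \<in> OL_unit_ball \<phi> w" "0 < c" "c < 1"
  shows "modular_le (\<lambda>k. c * x k) 1"
proof -
  have "1 < 1 / c" using assms(2,3) by simp
  then have "OL_norm \<phi> w x < 1 / c" using assms(1) by (simp add: OL_unit_ball_def)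
  then have "modular_le (\<lambda>k. x k / (1 / c)) 1"
    using assms(1) by (intro modular_le_of_OL_norm_less) (simp_all add: OL_unit_ball_def)
  then show ?thesis by (simp add: mult.commute)
qed

text \<open>For \<open>e > 2\<close>, \<open>(x - y) / e\<close> is the midpoint of
  \<open>2 / e * x\<close> and \<open>- (2 / e * y)\<close>, both of modular at most 1.\<close>

lemma OL_norm_diff_unit_ball:
  assumes "x \<in> OL_unit_ball \<phi> w" "y \<in> OL_unit_ball \<phi> w"
  shows "OL_norm \<phi> w (\<lambda>k. x k - y k) \<le> 2"
proof (rule dense_ge)
  fix e :: real assume e: "2 < e"
  have "0 < 2 / e" "2 / e < 1" using e by auto
  then have "modular_le (\<lambda>k. 2 / e * x k) 1" "modular_le (\<lambda>k. 2 / e * y k) 1"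
    by (simp_all only: OL_unit_ballD assms)
  moreover from this(2) have "modular_le (\<lambda>k. - (2 / e * y k)) 1"
    by (rule modular_le_mono) auto
  ultimately have "modular_le (\<lambda>k. 1 / 2 * (2 / e * x k) + (1 - 1 / 2) * (- (2 / e * y k))) (1 / 2 * 1 + (1 - 1 / 2) * 1)"
    by (intro modular_le_convex) auto
  then have "modular_le (\<lambda>k. (x k - y k) / e) 1"
    by (simp add: diff_divide_distrib)
  then show "OL_norm \<phi> w (\<lambda>k. x k - y k) \<le> e"
    using e by (intro OL_norm_le) auto
qed

section \<open>Functionals and weak convergence\<close>

lemma OL_dual_add:
  "f \<in> OL_dual \<phi> w \<Longrightarrow> x \<in> OL_space \<phi> w \<Longrightarrow> y \<in> OL_space \<phi> w \<Longrightarrow> f (\<lambda>k. x k + y k) = f x + f y"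
  and OL_dual_scale:
  "f \<in> OL_dual \<phi> w \<Longrightarrow> x \<in> OL_space \<phi> w \<Longrightarrow> f (\<lambda>k. c * x k) = c * f x"
  by (simp_all add: OL_dual_def)

lemma OL_dual_sum:
  fixes v :: "'i \<Rightarrow> nat \<Rightarrow> real"
  assumes f: "f \<in> OL_dual \<phi> w" and v: "\<And>n. v n \<in> OL_space \<phi> w" and "finite N"
  shows "(\<lambda>k. \<Sum>n\<in>N. v n k) \<in> OL_space \<phi> w \<and> f (\<lambda>k. \<Sum>n\<in>N. v n k) = (\<Sum>n\<in>N. f (v n))"
  using assms(3)
proof (induction N)
  case empty
  have "(\<lambda>k. 0) \<in> OL_space \<phi> w" by (auto simp: OL_space_iff modular_le_def intro!: exI[of _ 1])
  with OL_dual_scale[OF f this, of 0] show ?case by simp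
next
  case (insert n N)
  then show ?case using OL_space_add[OF v] OL_dual_add[OF f v] by simp
qed

text \<open>
  The disjoint pieces of a sequence in the space span a \<open>c\<^sub>0\<close>-like system, since all signed sums
  of them are dominated by the sequence itself.
\<close>

lemma OL_dual_disjoint_pieces_tendsto_zero:
  fixes C :: "nat \<Rightarrow> nat" and y :: "nat \<Rightarrow> real"
  assumes f: "f \<in> OL_dual \<phi> w" and y: "y \<in> OL_space \<phi> w"
  shows "(\<lambda>n. f (\<lambda>k. if C k = n then y k else 0)) \<longlonglongrightarrow> 0"
proof -
  define P where "P n k = (if C k = n then y k else 0)" for n k
  have P: "P n \<in> OL_space \<phi> w" for n
    by (rule OL_space_solid[OF y]) (simp add: P_def)
  obtain D where D: "\<And>x. x \<in> OL_space \<phi> w \<Longrightarrow> \<bar>f x\<bar> \<le> D * OL_norm \<phi> w x"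
    using f unfolding OL_dual_def by blast
  obtain l where l: "0 < l" "modular_le (\<lambda>k. l * y k) 1"
    using y by (auto simp: OL_space_iff)
  have bound: "(\<Sum>n<N. \<bar>f (P n)\<bar>) \<le> \<bar>D\<bar> * (1 / l)" for N
  proof -
    \<comment> \<open>The signs make \<open>f g\<close> the sum of the absolute values, while
      disjointness of the pieces keeps \<open>g\<close> dominated by \<open>y\<close>, uniformly in
      \<open>N\<close>.\<close>
    define g where "g k = (\<Sum>n<N. sgn (f (P n)) * P n k)" for k
    have g: "g \<in> OL_space \<phi> w \<and> f g = (\<Sum>n<N. f (\<lambda>k. sgn (f (P n)) * P n k))"
      unfolding g_def by (intro OL_dual_sum f OL_space_scale P) simp
    have "f g = (\<Sum>n<N. \<bar>f (P n)\<bar>)"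
      by (simp only: g OL_dual_scale[OF f P]) (simp add: abs_sgn mult.commute)
    have gy: "\<bar>g k\<bar> \<le> \<bar>y k\<bar>" for k
    proof -
      have "g k = (\<Sum>n<N. if n = C k then sgn (f (P n)) * y k else 0)"
        unfolding g_def P_def by (intro sum.cong) auto
      then show ?thesis by (simp add: abs_mult abs_sgn_eq)
    qed
    have "modular_le (\<lambda>k. g k / (1 / l)) 1"
      by (rule modular_le_mono[OF l(2)])
        (use l(1) gy in \<open>auto simp: abs_mult mult.commute intro: mult_left_mono\<close>)
    then have "OL_norm \<phi> w g \<le> 1 / l" using l(1) by (intro OL_norm_le) auto
    \<comment> \<open>The constant \<open>D\<close> comes without a sign, hence its absolute
      value.\<close>
    then have "\<bar>D\<bar> * OL_norm \<phi> w g \<le> \<bar>D\<bar> * (1 / l)" by (rule mult_left_mono) simp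
    moreover have "D * OL_norm \<phi> w g \<le> \<bar>D\<bar> * OL_norm \<phi> w g"
      using OL_norm_nonneg[of g] g by (intro mult_right_mono) auto
    ultimately show ?thesis
      using D[of g] g \<open>f g = _\<close> by simp
  qed
  have "summable (\<lambda>n. \<bar>f (P n)\<bar>)"
    by (rule summableI_nonneg_bounded[OF _ bound]) simp
  then have "(\<lambda>n. f (P n)) \<longlonglongrightarrow> 0"
    using summable_LIMSEQ_zero tendsto_rabs_zero_iff by blast
  then show ?thesis by (simp add: P_def[abs_def])
qed

text \<open>Convergence under each functional handles the subbasic sets; the induction along the
  generation of the topology carries it through finite intersections and unions.\<close>

lemma eventually_in_weakly_open:
  assumes "openin (OL_weak_topology \<phi> w) V" "y \<in> V"
    and seq: "\<And>n. s n \<in> OL_space \<phi> w"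
    and conv: "\<And>f. f \<in> OL_dual \<phi> w \<Longrightarrow> (\<lambda>n. f (s n)) \<longlonglongrightarrow> f y"
  shows "\<forall>\<^sub>F n in sequentially. s n \<in> V"
proof -
  have "generate_topology_on {{x \<in> OL_space \<phi> w. f x \<in> V} | f V. f \<in> OL_dual \<phi> w \<and> open V} V"
    using assms(1) by (simp add: OL_weak_topology_def openin_topology_generated_by_iff)
  then show ?thesis using assms(2)
  proof (induction V)
    case Empty
    then show ?case by simp
  next
    case (Int a b)
    then have "\<forall>\<^sub>F n in sequentially. s n \<in> a" "\<forall>\<^sub>F n in sequentially. s n \<in> b" by auto
    then show ?case by eventually_elim simp
  next
    case (UN K)
    then obtain k where "k \<in> K" "y \<in> k" by blast
    with UN have "\<forall>\<^sub>F n in sequentially. s n \<in> k" by blast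
    then show ?case by eventually_elim (use \<open>k \<in> K\<close> in blast)
  next
    case (Basis b)
    then obtain f V where fV: "f \<in> OL_dual \<phi> w" "open V" "b = {x \<in> OL_space \<phi> w. f x \<in> V}"
      by blast
    then have "\<forall>\<^sub>F n in sequentially. f (s n) \<in> V"
      using Basis.prems by (intro topological_tendstoD[OF conv]) auto
    then show ?case by eventually_elim (simp add: fV seq)
  qed
qed

section \<open>Blocks of small modular and large norm\<close>

text \<open>If \<open>\<phi> (a * u) \<le> K * \<phi> u\<close> held on all of
  \<open>(0, u0]\<close>, iterating until \<open>a ^ n > 2\<close> would give
  \<open>delta2_zero\<close> with constant \<open>K ^ n\<close> on
  \<open>[0, u0 / a ^ n]\<close>.\<close>

lemma not_delta2_zero_dilation:
  assumes "\<not> delta2_zero \<phi>" "1 < a" "0 < K" "0 < u0"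
  shows "\<exists>u>0. u \<le> u0 \<and> K * \<phi> u < \<phi> (a * u)"
proof (rule ccontr)
  assume "\<not> ?thesis"
  then have step: "\<phi> (a * u) \<le> K * \<phi> u" if "0 \<le> u" "u \<le> u0" for u
    using that by (cases "u = 0") (auto simp: not_less)
  have iter: "\<phi> (a ^ n * u) \<le> K ^ n * \<phi> u" if "0 \<le> u" "a ^ n * u \<le> u0" for n u
    using that
  proof (induction n)
    case (Suc n)
    have "1 * (a ^ n * u) \<le> a * (a ^ n * u)"
      using Suc.prems(1) assms(2) by (intro mult_right_mono) auto
    then have le: "a ^ n * u \<le> u0" using Suc.prems(2) by (simp add: mult.assoc)
    have "\<phi> (a * (a ^ n * u)) \<le> K * \<phi> (a ^ n * u)"
      using Suc.prems(1) assms(2) le by (intro step) auto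
    also have "\<dots> \<le> K * (K ^ n * \<phi> u)"
      using Suc le assms(3) by (intro mult_left_mono) auto
    finally show ?case by (simp add: mult.assoc)
  qed simp
  obtain n where n: "2 < a ^ n" using real_arch_pow[OF assms(2)] by blast
  have "\<phi> (2 * u) \<le> K ^ n * \<phi> u" if "0 \<le> u" "u \<le> u0 / a ^ n" for u
  proof -
    have "\<phi> (2 * u) \<le> \<phi> (a ^ n * u)"
      using that n by (intro phi_mono mult_right_mono) auto
    also have "\<dots> \<le> K ^ n * \<phi> u"
      using that n assms(2) by (intro iter) (auto simp: field_simps)
    finally show ?thesis .
  qed
  moreover have "0 < K ^ n" "0 < u0 / a ^ n" using assms by auto
  ultimately have "delta2_zero \<phi>" unfolding delta2_zero_def by blast
  then show False using assms(1) by contradiction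
qed

text \<open>A block of constant height \<open>u\<close> and length \<open>m\<close> has modular \<open>\<phi>(u) W(m)\<close>.\<close>

lemma exists_block:
  assumes tot: "total_weight w = \<infinity>" and "\<not> delta2_zero \<phi>" "1 < a" "0 < \<epsilon>"
  shows "\<exists>u>0. \<exists>m. \<phi> u * (\<Sum>k<m. w k) \<le> \<epsilon> \<and> 1 < \<phi> (a * u) * (\<Sum>k<m. w k)"
proof -
  define c where "c = \<phi> 1 * w 0"
  \<comment> \<open>The cap 1 allows \<open>\<phi> u \<le> u * \<phi> 1\<close>; the second bound
    then makes each increment \<open>\<phi> u * w k\<close> at most
    \<open>\<epsilon> / 2\<close>.\<close>
  define u0 where "u0 = min 1 (\<epsilon> / 2 / c)"
  have c: "0 < c" using phi_pos[of 1] w_pos[of 0] by (simp add: c_def)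
  have "0 < u0" using c assms(4) by (simp add: u0_def)
  then obtain u where u: "0 < u" "u \<le> u0" "2 / \<epsilon> * \<phi> u < \<phi> (a * u)"
    using not_delta2_zero_dilation[of a "2 / \<epsilon>" u0] assms by auto
  have phiu: "0 < \<phi> u" using u by (simp add: phi_pos)
  have "\<phi> (u * 1) \<le> u * \<phi> 1" using u by (intro phi_scale) (auto simp: u0_def)
  then have "\<phi> u * w 0 \<le> u * \<phi> 1 * w 0" using w_nonneg[of 0] by (intro mult_right_mono) auto
  also have "\<dots> = u * c" by (simp add: c_def)
  also have "\<dots> \<le> \<epsilon> / 2 / c * c"
    using u c by (intro mult_right_mono) (auto simp: u0_def)
  also have "\<dots> = \<epsilon> / 2" using c by simp
  finally have small: "\<phi> u * w 0 \<le> \<epsilon> / 2" .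
  let ?W = "\<lambda>m. \<Sum>k<m. w k"
  have "\<exists>m. \<epsilon> < \<phi> u * ?W m"
  proof (rule ccontr)
    assume "\<not> ?thesis"
    then have "?W m \<le> \<epsilon> / \<phi> u" for m
      using phiu by (auto simp: not_less field_simps)
    then have "(\<Sum>k<m. ennreal (w k)) \<le> ennreal (\<epsilon> / \<phi> u)" for m
      by (subst sum_ennreal) (auto intro!: ennreal_leI w_nonneg)
    then have "total_weight w \<le> ennreal (\<epsilon> / \<phi> u)"
      unfolding total_weight_def by (intro suminf_le_const) auto
    then show False using tot by (simp add: top_unique)
  qed
  \<comment> \<open>At the first length that overshoots \<open>\<epsilon>\<close>, the predecessor
    \<open>n\<close> has \<open>\<phi> u * ?W n\<close> above \<open>\<epsilon> / 2\<close> and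
    still at most \<open>\<epsilon>\<close>. The factor \<open>2 / \<epsilon>\<close> gained by
    passing to \<open>a * u\<close> lifts this above 1.\<close>
  then obtain m where m: "\<epsilon> < \<phi> u * ?W m" "\<And>n. n < m \<Longrightarrow> \<phi> u * ?W n \<le> \<epsilon>"
    using exists_least_iff[of "\<lambda>m. \<epsilon> < \<phi> u * ?W m"] by (auto simp: not_less)
  have "m \<noteq> 0" using m(1) assms(4) by (intro notI) simp
  then obtain n where n: "m = Suc n" using not0_implies_Suc by blast
  have "\<phi> u * w n \<le> \<phi> u * w 0"
    using w_decseq phiu by (intro mult_left_mono) (auto simp: decseqD)
  then have "\<epsilon> / 2 < \<phi> u * ?W n" using m(1) small by (simp add: n algebra_simps)
  then have "1 < 2 / \<epsilon> * \<phi> u * ?W n" using assms(4) by (simp add: field_simps)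
  also have "\<dots> \<le> \<phi> (a * u) * ?W n"
    using u by (intro mult_right_mono sum_nonneg w_nonneg) auto
  finally show ?thesis using u(1) m(2)[of n] n by blast
qed

text \<open>The pairing bijection cuts the indices into infinite columns; block \<open>n\<close>
  fills the first \<open>m n\<close> places of column \<open>n\<close>. As the modular bounds sum to
  1, all blocks together form one element \<open>z\<close> of the space, so they are disjoint pieces
  of \<open>z\<close>.\<close>

lemma exists_block_sequence:
  assumes "total_weight w = \<infinity>" "\<not> delta2_zero \<phi>" "1 < a"
  obtains z :: "nat \<Rightarrow> real" and C :: "nat \<Rightarrow> nat" where "z \<in> OL_space \<phi> w"
    and "\<And>n. modular_le (\<lambda>k. if C k = n then z k else 0) ((1 / 2) ^ Suc n)"
    and "\<And>n. \<not> modular_le (\<lambda>k. a * (if C k = n then z k else 0)) 1"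
proof -
  have "\<forall>n. \<exists>u m. 0 < u \<and> \<phi> u * (\<Sum>k<m. w k) \<le> (1 / 2) ^ Suc n \<and> 1 < \<phi> (a * u) * (\<Sum>k<m. w k)"
    using exists_block[OF assms, of "(1 / 2) ^ Suc _"] by (metis zero_less_power half_gt_zero_iff zero_less_one)
  then obtain u m where um: "\<And>n :: nat. 0 < u n" "\<And>n. \<phi> (u n) * (\<Sum>k<m n. w k) \<le> (1 / 2) ^ Suc n"
    "\<And>n. 1 < \<phi> (a * u n) * (\<Sum>k<m n. w k)"
    by metis
  define C :: "nat \<Rightarrow> nat" where "C k = fst (prod_decode k)" for k
  define z where "z k = (if snd (prod_decode k) < m (C k) then u (C k) else 0)" for k
  have piece: "(\<Sum>k\<in>{k \<in> K. C (i k) = n}. \<phi> \<bar>z (i k)\<bar> * w k) \<le> (1 / 2) ^ Suc n"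
    if K: "finite K" "inj_on i K" for K n and i :: "nat \<Rightarrow> nat"
  proof -
    \<comment> \<open>\<open>L\<close> indexes the entries of block \<open>n\<close> that are met.
      Their places in the column are distinct and below \<open>m n\<close>, so \<open>L\<close> has
      at most \<open>m n\<close> elements.\<close>
    define L where "L = {k \<in> K. C (i k) = n \<and> snd (prod_decode (i k)) < m n}"
    have "inj_on (\<lambda>k. snd (prod_decode (i k))) L"
    proof (rule inj_onI)
      fix j k assume jk: "j \<in> L" "k \<in> L" "snd (prod_decode (i j)) = snd (prod_decode (i k))"
      then have "prod_decode (i j) = prod_decode (i k)"
        by (auto simp: L_def C_def prod_eq_iff)
      then have "i j = i k" by (metis prod_decode_inverse)
      then show "j = k" using jk K(2) by (auto simp: L_def inj_on_def)
    qed
    then have "card L \<le> card {..<m n}"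
      by (rule card_inj_on_le) (auto simp: L_def)
    then have "sum w L \<le> (\<Sum>k<m n. w k)"
      using K(1) by (intro sum_decseq_le_initial w_decseq w_nonneg) (auto simp: L_def)
    then have "\<phi> (u n) * sum w L \<le> \<phi> (u n) * (\<Sum>k<m n. w k)"
      using um(1)[of n] by (intro mult_left_mono phi_nonneg) auto
    moreover have "(\<Sum>k\<in>{k \<in> K. C (i k) = n}. \<phi> \<bar>z (i k)\<bar> * w k) = (\<Sum>k\<in>L. \<phi> (u n) * w k)"
      using K(1) um(1)[of n] by (intro sum.mono_neutral_cong_right) (auto simp: L_def z_def)
    ultimately show ?thesis using um(2)[of n] by (simp add: sum_distrib_left)
  qed
  have "modular_le z 1"
    unfolding modular_le_def
  proof (intro allI impI)
    fix K and i :: "nat \<Rightarrow> nat"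
    assume K: "finite K" "inj_on i K"
    have "(\<Sum>k\<in>K. \<phi> \<bar>z (i k)\<bar> * w k)
        = (\<Sum>n\<in>(\<lambda>k. C (i k)) ` K. \<Sum>k\<in>{k \<in> K. C (i k) = n}. \<phi> \<bar>z (i k)\<bar> * w k)"
      using K by (intro sum.group[symmetric]) auto
    also have "\<dots> \<le> (\<Sum>n\<in>(\<lambda>k. C (i k)) ` K. (1 / 2) ^ Suc n)"
      by (intro sum_mono piece K)
    also have "\<dots> \<le> (\<Sum>n. (1 / 2 :: real) ^ Suc n)"
      using K sums_summable[OF power_half_series] by (intro sum_le_suminf) auto
    also have "\<dots> = 1" using sums_unique[OF power_half_series] by simp
    finally show "(\<Sum>k\<in>K. \<phi> \<bar>z (i k)\<bar> * w k) \<le> 1" .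
  qed
  then have "z \<in> OL_space \<phi> w"
    using OL_unit_ballI by (simp add: OL_unit_ball_def)
  moreover have "modular_le (\<lambda>k. if C k = n then z k else 0) ((1 / 2) ^ Suc n)" for n
    unfolding modular_le_def
  proof (intro allI impI)
    fix K and i :: "nat \<Rightarrow> nat"
    assume K: "finite K" "inj_on i K"
    have "(\<Sum>k\<in>K. \<phi> \<bar>if C (i k) = n then z (i k) else 0\<bar> * w k)
        = (\<Sum>k\<in>{k \<in> K. C (i k) = n}. \<phi> \<bar>z (i k)\<bar> * w k)"
      using K by (intro sum.mono_neutral_cong_right) auto
    also note piece[OF K]
    finally show "(\<Sum>k\<in>K. \<phi> \<bar>if C (i k) = n then z (i k) else 0\<bar> * w k) \<le> (1 / 2) ^ Suc n" .
  qed
  moreover have "\<not> modular_le (\<lambda>k. a * (if C k = n then z k else 0)) 1" for n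
  proof
    assume le: "modular_le (\<lambda>k. a * (if C k = n then z k else 0)) 1"
    \<comment> \<open>Pairing the block with the first \<open>m n\<close> weights attains its full
      modular.\<close>
    have "inj_on (\<lambda>k. prod_encode (n, k)) {..<m n}"
      by (auto simp: inj_on_def)
    from modular_leD[OF le _ this]
    have "(\<Sum>k<m n. \<phi> \<bar>a * u n\<bar> * w k) \<le> 1"
      by (simp add: C_def z_def)
    then show False
      using um(1,3)[of n] assms(3) by (simp add: sum_distrib_left[symmetric])
  qed
  ultimately show ?thesis by (rule that)
qed

section \<open>Points at distance almost two in a weakly open set\<close>

lemma distant_points_in_weakly_open:
  assumes tot: "total_weight w = \<infinity>" and nd: "\<not> delta2_zero \<phi>" and "1 < a"
    and V: "openin (OL_weak_topology \<phi> w) V"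
    and x: "x \<in> V" "x \<in> OL_unit_ball \<phi> w"
  shows "\<exists>p\<in>V \<inter> OL_unit_ball \<phi> w. \<exists>q\<in>V \<inter> OL_unit_ball \<phi> w.
    2 / a \<le> OL_norm \<phi> w (\<lambda>k. p k - q k)"
proof -
  have xs: "x \<in> OL_space \<phi> w" using x(2) by (simp add: OL_unit_ball_def)
  \<comment> \<open>The factor is used twice: once to pass from norm at most 1 to modular at most 1,
    and once more to push the modular down to \<open>s < 1\<close> by convexity.\<close>
  define t where "t n = 1 - (1 / 2 :: real) ^ Suc n" for n
  have pow: "(\<lambda>n. (1 / 2 :: real) ^ Suc n) \<longlonglongrightarrow> 0"
    by (rule LIMSEQ_Suc[OF LIMSEQ_power_zero]) simp
  have t: "0 < t n" "t n < 1" for n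
    using power_decreasing[of 1 "Suc n" "1 / 2 :: real"] by (auto simp: t_def)
  have "t \<longlonglongrightarrow> 1"
    using tendsto_diff[OF tendsto_const[of 1] pow] by (simp add: t_def[abs_def])
  then have "(\<lambda>n. t n * t n * f x) \<longlonglongrightarrow> 1 * 1 * f x" for f :: "(nat \<Rightarrow> real) \<Rightarrow> real"
    by (intro tendsto_intros)
  then have "\<forall>\<^sub>F n in sequentially. (\<lambda>k. (t n * t n) * x k) \<in> V"
    by (intro eventually_in_weakly_open[OF V x(1) OL_space_scale[OF xs]])
      (simp only: OL_dual_scale[OF _ xs], simp)
  then obtain j where j: "(\<lambda>k. (t j * t j) * x k) \<in> V"
    using eventually_happens by force
  define s where "s = t j"
  define y where "y k = s * (s * x k)" for k
  have yV: "y \<in> V" using j by (simp add: y_def[abs_def] s_def mult.assoc)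
  have s: "0 < s" "s < 1" using t by (auto simp: s_def)
  have ys: "y \<in> OL_space \<phi> w" unfolding y_def by (intro OL_space_scale xs)
  have "modular_le (\<lambda>k. s * x k) 1" using s by (intro OL_unit_ballD[OF x(2)])
  then have y: "modular_le y s"
    using modular_le_scale[of "\<lambda>k. s * x k" 1 s] s by (simp add: y_def[abs_def])
  obtain z C where zC: "z \<in> OL_space \<phi> w"
    "\<And>n. modular_le (\<lambda>k. if C k = n then z k else 0) ((1 / 2) ^ Suc n)"
    "\<And>n. \<not> modular_le (\<lambda>k. a * (if C k = n then z k else 0)) 1"
    by (rule exists_block_sequence[OF tot nd assms(3)]) (rule that)
  define Z where "Z n k = (if C k = n then z k else 0)" for n :: nat and k
  define Y where "Y n k = (if C k = n then y k else 0)" for n :: nat and k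
  have Z: "Z n \<in> OL_space \<phi> w" for n
    by (rule OL_space_solid[OF zC(1)]) (simp add: Z_def)
  have Y: "Y n \<in> OL_space \<phi> w" for n
    by (rule OL_space_solid[OF ys]) (simp add: Y_def)
  \<comment> \<open>This is \<open>y\<close> with its piece on column \<open>n\<close> replaced by
    \<open>\<sigma>\<close> times the block.\<close>
  define p where "p \<sigma> n k = y k + (\<sigma> * Z n k + (-1) * Y n k)" for \<sigma> n k
  have ps: "p \<sigma> n \<in> OL_space \<phi> w" for \<sigma> n
    unfolding p_def by (intro OL_space_add OL_space_scale Z Y ys)
  have pV: "\<forall>\<^sub>F n in sequentially. p \<sigma> n \<in> V" for \<sigma>
  proof (rule eventually_in_weakly_open[OF V yV ps])
    fix f assume f: "f \<in> OL_dual \<phi> w"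
    have "(\<lambda>n. f y + (\<sigma> * f (Z n) + (-1) * f (Y n))) \<longlonglongrightarrow> f y + (\<sigma> * 0 + (-1) * 0)"
      unfolding Z_def Y_def
      by (intro tendsto_intros OL_dual_disjoint_pieces_tendsto_zero[OF f] zC(1) ys)
    moreover have "f (p \<sigma> n) = f y + (\<sigma> * f (Z n) + (-1) * f (Y n))" for n
    proof -
      have "f (p \<sigma> n) = f y + f (\<lambda>k. \<sigma> * Z n k + (-1) * Y n k)"
        unfolding p_def by (intro OL_dual_add f ys OL_space_add OL_space_scale Z Y)
      also have "f (\<lambda>k. \<sigma> * Z n k + (-1) * Y n k) = f (\<lambda>k. \<sigma> * Z n k) + f (\<lambda>k. (-1) * Y n k)"
        by (intro OL_dual_add f OL_space_scale Z Y)
      finally show ?thesis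
        by (simp only: OL_dual_scale[OF f Z] OL_dual_scale[OF f Y])
    qed
    ultimately show "(\<lambda>n. f (p \<sigma> n)) \<longlonglongrightarrow> f y" by simp
  qed
  \<comment> \<open>The modular of the block must fit into the room \<open>1 - s\<close> left by
    \<open>y\<close>.\<close>
  have small: "\<forall>\<^sub>F n in sequentially. (1 / 2 :: real) ^ Suc n < 1 - s"
    using s by (intro order_tendstoD(2)[OF pow]) simp
  have "\<forall>\<^sub>F n in sequentially. p 1 n \<in> V \<and> p (-1) n \<in> V \<and> (1 / 2 :: real) ^ Suc n < 1 - s"
    by (intro eventually_conj pV small)
  then obtain n where n: "p 1 n \<in> V" "p (-1) n \<in> V" "(1 / 2 :: real) ^ Suc n < 1 - s"
    using eventually_happens by force
  have ball: "p \<sigma> n \<in> OL_unit_ball \<phi> w" if "\<bar>\<sigma>\<bar> = 1" for \<sigma>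
  proof (rule OL_unit_ballI)
    have "modular_le (p \<sigma> n) ((1 / 2) ^ Suc n + s)"
      by (rule modular_le_orthogonal_add[OF zC(2) y, of "{k. C k = n}"])
        (auto simp: p_def Z_def Y_def abs_mult that)
    then show "modular_le (p \<sigma> n) 1"
      by (rule modular_le_mono) (use n in auto)
  qed
  have diff: "p 1 n k - p (-1) n k = 2 * Z n k" for k by (simp add: p_def)
  \<comment> \<open>A norm below \<open>2 / a\<close> would give \<open>a * Z n\<close> modular at
    most 1, contrary to the choice of the block.\<close>
  have "2 / a \<le> OL_norm \<phi> w (\<lambda>k. 2 * Z n k)"
  proof (rule ccontr)
    assume "\<not> ?thesis"
    then have "modular_le (\<lambda>k. 2 * Z n k / (2 / a)) 1"
      by (intro modular_le_of_OL_norm_less OL_space_scale Z) simp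
    then have "modular_le (\<lambda>k. a * Z n k) 1" by (simp add: mult.commute)
    then show False using zC(3)[of n] by (simp add: Z_def)
  qed
  then show ?thesis
    using n ball[of 1] ball[of "-1"] by (intro bexI[of _ "p 1 n"] bexI[of _ "p (-1) n"]) (auto simp: diff)
qed

end

theorem theorem3p3:
  fixes w :: "nat \<Rightarrow> real" and \<phi> :: "real \<Rightarrow> real" and U :: "(nat \<Rightarrow> real) set"
  assumes "weight_sequence w"
    and "total_weight w = \<infinity>"
    and "orlicz_N_function \<phi>"
    and "\<not> delta2_zero \<phi>"
    and "openin (subtopology (OL_weak_topology \<phi> w) (OL_unit_ball \<phi> w)) U"
    and "U \<noteq> {}"
  shows "OL_diameter \<phi> w U = 2"
proof -
  interpret orlicz_lorentz \<phi> w
    using assms(1,3) by unfold_locales (simp_all add: orlicz_N_function_def)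
  obtain V where V: "openin (OL_weak_topology \<phi> w) V" "U = V \<inter> OL_unit_ball \<phi> w"
    using assms(5) by (auto simp: openin_subtopology)
  obtain x where x: "x \<in> V" "x \<in> OL_unit_ball \<phi> w" using assms(6) V(2) by blast
  have "OL_diameter \<phi> w U \<le> 2"
    unfolding OL_diameter_def
    using OL_norm_diff_unit_ball by (intro SUP_least) (auto simp: V(2))
  moreover have "2 \<le> OL_diameter \<phi> w U"
  proof (rule dense_le)
    fix c :: ereal assume c: "c < 2"
    \<comment> \<open>The value \<open>c\<close> may be negative or minus infinity, so
      \<open>b\<close> is taken above \<open>max c 1\<close>; then \<open>a = 2 / b\<close> exceeds
      1 and \<open>2 / a = b\<close>.\<close>
    obtain b :: real where b: "c < ereal b" "b < 2" "0 < b"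
    proof -
      have "max c 1 < 2" using c by simp
      then obtain b where b: "max c 1 < ereal b" "ereal b < 2"
        using ereal_dense2 by blast
      then have "1 < b" "b < 2" by auto
      then show thesis using b that[of b] by auto
    qed
    obtain p q where pq: "p \<in> U" "q \<in> U" "b \<le> OL_norm \<phi> w (\<lambda>k. p k - q k)"
      using distant_points_in_weakly_open[OF assms(2,4), of "2 / b" V x] b V x by auto
    have "c \<le> ereal (OL_norm \<phi> w (\<lambda>k. p k - q k))"
      using b(1) pq(3) by (meson ereal_less_eq(3) less_imp_le order_trans)
    also have "\<dots> \<le> OL_diameter \<phi> w U"
      unfolding OL_diameter_def using pq by (intro SUP_upper2[of "(p, q)"]) auto
    finally show "c \<le> OL_diameter \<phi> w U" .
  qed
  ultimately show ?thesis by (rule antisym)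
qed

end
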